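(* Let $X$ be a weighted pure $n$-dimensional finite simplicial complex and let $0\le\lambda\le1$ be a constant. If $X$ is a one-sided $\lambda$-local-spectral expander, then for every $0\le k\le n-1$ and every $\phi\in C_0^k(X,\mathbb{R})$, $$\|M_k^+\phi\|\le\left(\frac{k+1}{k+2}+\frac{k+1}{2}\lambda\right)\|\phi\|.$$
   Context: A finite simplicial complex $X$ is pure $n$-dimensional ($n\ge1$) if every simplex is contained in an $n$-dimensional simplex. $X(k)$ is the set of $k$-dimensional simplices, with $X(-1)=\{\emptyset\}$. A weight function is a map $m:\bigcup_{-1\le k\le n}X(k)\to(0,\infty)$ with $m(\tau)=\sum_{\sigma\in X(k+1),\,\tau\subset\sigma}m(\sigma)$ for all $-1\le k\le n-1$, $\tau\in X(k)$. $C^k(X,\mathbb{R})$ is the space of all functions $X(k)\to\mathbb{R}$ with inner product $\langle\phi,\psi\rangle=\sum_{\sigma\in X(k)}m(\sigma)\phi(\sigma)\psi(\sigma)$ and norm $\|\cdot\|$. $C_0^k(X,\mathbb{R})=\{\phi\in C^k(X,\mathbb{R}):\sum_{\sigma\in X(k)}m(\sigma)\phi(\sigma)=0\}$. For $0\le k\le n-1$ the upper random walk operator $M_k^+$ on $C^k(X,\mathbb{R})$ is $M_k^+\phi(\tau)=\sum_{\tau'\in X(k)}M_k^+(\tau,\tau')\phi(\tau')$, where $M_k^+(\tau,\tau)=\frac1{k+2}$, $M_k^+(\tau,\tau')=\frac{m(\tau\cup\tau')}{(k+2)m(\tau)}$ if $\tau\cup\tau'\in X(k+1)$, and $0$ otherwise.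 For $\tau\in X(i)$, $-1\le i\le n-2$, the link $X_\tau$ is the complex of all simplices $\eta$ disjoint from $\tau$ with $\tau\cup\eta\in X$, with weight $m_\tau(\eta)=m(\tau\cup\eta)$. The non-lazy walk operator on functions $f$ on the vertices of $X_\tau$ is $f\mapsto\left(v\mapsto\sum_{w:\{v,w\}\in X_\tau(1)}\frac{m_\tau(\{v,w\})}{m_\tau(\{v\})}f(w)\right)$; it is self-adjoint with largest eigenvalue $1$, and $\mu_\tau$ denotes its second largest eigenvalue (counted with multiplicity). $X$ is a one-sided $\lambda$-local-spectral expander if $\mu_\tau\le\lambda$ for every $\tau\in X(i)$ and every $-1\le i\le n-2$. *)

theory Defs
  imports
    "HOL-Analysis.Analysis"
    "HOL-Library.Multiset"
    "HOL-Library.Function_Algebras"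
begin

text \<open>A complex is the set of all its simplices, the empty simplex included.  Dimensions are
  integers, so that the empty simplex has dimension \<open>-1\<close>.\<close>

definition finite_simplicial_complex :: "'a set set \<Rightarrow> bool" where
  "finite_simplicial_complex X \<longleftrightarrow>
     finite X \<and> {} \<in> X \<and> (\<forall>\<sigma>\<in>X. finite \<sigma>) \<and> (\<forall>\<sigma>\<in>X. \<forall>\<tau>. \<tau> \<subseteq> \<sigma> \<longrightarrow> \<tau> \<in> X)"

definition faces :: "'a set set \<Rightarrow> int \<Rightarrow> 'a set set" where
  "faces X k = {\<sigma> \<in> X. int (card \<sigma>) = k + 1}"

definition pure_complex :: "'a set set \<Rightarrow> int \<Rightarrow> bool" where
  "pure_complex X n \<longleftrightarrow>
     finite_simplicial_complex X \<and> (\<forall>\<tau>\<in>X. \<exists>\<sigma>\<in>faces X n. \<tau> \<subseteq> \<sigma>)"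

text \<open>Only the values of \<open>m\<close> on the simplices of \<open>X\<close> are relevant.\<close>

definition weight_function :: "'a set set \<Rightarrow> int \<Rightarrow> ('a set \<Rightarrow> real) \<Rightarrow> bool" where
  "weight_function X n m \<longleftrightarrow>
     (\<forall>k\<in>{-1..n}. \<forall>\<sigma>\<in>faces X k. 0 < m \<sigma>) \<and>
     (\<forall>k\<in>{-1..n-1}. \<forall>\<tau>\<in>faces X k. m \<tau> = (\<Sum>\<sigma> | \<sigma> \<in> faces X (k + 1) \<and> \<tau> \<subset> \<sigma>. m \<sigma>))"

text \<open>Real functions on a set \<open>A\<close> are represented by functions on the whole type that vanish
  outside \<open>A\<close>, so that they form a subspace of a function space.\<close>

definition functions_on :: "'b set \<Rightarrow> ('b \<Rightarrow> real) set" where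
  "functions_on A = {f. \<forall>a. a \<notin> A \<longrightarrow> f a = 0}"

definition cochains :: "'a set set \<Rightarrow> int \<Rightarrow> ('a set \<Rightarrow> real) set" where
  "cochains X k = functions_on (faces X k)"

definition cochain_inner ::
  "'a set set \<Rightarrow> ('a set \<Rightarrow> real) \<Rightarrow> int \<Rightarrow> ('a set \<Rightarrow> real) \<Rightarrow> ('a set \<Rightarrow> real) \<Rightarrow> real" where
  "cochain_inner X m k \<phi> \<psi> = (\<Sum>\<sigma>\<in>faces X k. m \<sigma> * \<phi> \<sigma> * \<psi> \<sigma>)"

definition cochain_norm ::
  "'a set set \<Rightarrow> ('a set \<Rightarrow> real) \<Rightarrow> int \<Rightarrow> ('a set \<Rightarrow> real) \<Rightarrow> real" where
  "cochain_norm X m k \<phi> = sqrt (cochain_inner X m k \<phi> \<phi>)"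

definition cochains0 :: "'a set set \<Rightarrow> ('a set \<Rightarrow> real) \<Rightarrow> int \<Rightarrow> ('a set \<Rightarrow> real) set" where
  "cochains0 X m k = {\<phi> \<in> cochains X k. (\<Sum>\<sigma>\<in>faces X k. m \<sigma> * \<phi> \<sigma>) = 0}"

definition upper_walk_kernel ::
  "'a set set \<Rightarrow> ('a set \<Rightarrow> real) \<Rightarrow> int \<Rightarrow> 'a set \<Rightarrow> 'a set \<Rightarrow> real" where
  "upper_walk_kernel X m k \<tau> \<tau>' =
     (if \<tau> = \<tau>' then 1 / (of_int k + 2)
      else if \<tau> \<union> \<tau>' \<in> faces X (k + 1) then m (\<tau> \<union> \<tau>') / ((of_int k + 2) * m \<tau>)
      else 0)"

definition upper_walk ::
  "'a set set \<Rightarrow> ('a set \<Rightarrow> real) \<Rightarrow> int \<Rightarrow> ('a set \<Rightarrow> real) \<Rightarrow> ('a set \<Rightarrow> real)" where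
  "upper_walk X m k \<phi> =
     (\<lambda>\<tau>. if \<tau> \<in> faces X k then \<Sum>\<tau>'\<in>faces X k. upper_walk_kernel X m k \<tau> \<tau>' * \<phi> \<tau>' else 0)"

definition link :: "'a set set \<Rightarrow> 'a set \<Rightarrow> 'a set set" where
  "link X \<tau> = {\<eta> \<in> X. \<eta> \<inter> \<tau> = {} \<and> \<tau> \<union> \<eta> \<in> X}"

definition link_weight :: "('a set \<Rightarrow> real) \<Rightarrow> 'a set \<Rightarrow> 'a set \<Rightarrow> real" where
  "link_weight m \<tau> \<eta> = m (\<tau> \<union> \<eta>)"

definition vertices :: "'a set set \<Rightarrow> 'a set" where
  "vertices Y = {v. {v} \<in> Y}"

definition nonlazy_walk ::
  "'a set set \<Rightarrow> ('a set \<Rightarrow> real) \<Rightarrow> ('a \<Rightarrow> real) \<Rightarrow> ('a \<Rightarrow> real)" where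
  "nonlazy_walk Y m f =
     (\<lambda>v. if v \<in> vertices Y then \<Sum>w | {v, w} \<in> faces Y 1. m {v, w} / m {v} * f w else 0)"

global_interpretation fun_vs: vector_space "\<lambda>(c::real) (f :: 'b \<Rightarrow> real). (\<lambda>x. c * f x)"
  by unfold_locales (auto simp: fun_eq_iff algebra_simps)

definition eigenspace ::
  "('b \<Rightarrow> real) set \<Rightarrow> (('b \<Rightarrow> real) \<Rightarrow> ('b \<Rightarrow> real)) \<Rightarrow> real \<Rightarrow> ('b \<Rightarrow> real) set" where
  "eigenspace S T x = {f \<in> S. T f = (\<lambda>b. x * f b)}"

definition eigenvalues ::
  "('b \<Rightarrow> real) set \<Rightarrow> (('b \<Rightarrow> real) \<Rightarrow> ('b \<Rightarrow> real)) \<Rightarrow> real set" where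
  "eigenvalues S T = {x. \<exists>f\<in>eigenspace S T x. f \<noteq> (\<lambda>b. 0)}"

text \<open>The multiplicity of an eigenvalue is the dimension of its eigenspace; the definition is only
  meant for self-adjoint operators on a finite-dimensional space \<open>S\<close>, for which this is also the
  algebraic multiplicity.\<close>

definition eigenvalue_mset ::
  "('b \<Rightarrow> real) set \<Rightarrow> (('b \<Rightarrow> real) \<Rightarrow> ('b \<Rightarrow> real)) \<Rightarrow> real multiset" where
  "eigenvalue_mset S T = (\<Sum>x\<in>eigenvalues S T. replicate_mset (fun_vs.dim (eigenspace S T x)) x)"

text \<open>Remove one copy of the largest eigenvalue and take the largest remaining one.  This is only
  meaningful if \<open>S\<close> has dimension at least 2.\<close>

definition second_largest_eigenvalue ::
  "('b \<Rightarrow> real) set \<Rightarrow> (('b \<Rightarrow> real) \<Rightarrow> ('b \<Rightarrow> real)) \<Rightarrow> real" where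
  "second_largest_eigenvalue S T =
     (let M = eigenvalue_mset S T in Max_mset (M - {#Max_mset M#}))"

definition link_mu :: "'a set set \<Rightarrow> ('a set \<Rightarrow> real) \<Rightarrow> 'a set \<Rightarrow> real" where
  "link_mu X m \<tau> =
     second_largest_eigenvalue (functions_on (vertices (link X \<tau>)))
       (nonlazy_walk (link X \<tau>) (link_weight m \<tau>))"

definition one_sided_local_spectral_expander ::
  "'a set set \<Rightarrow> int \<Rightarrow> ('a set \<Rightarrow> real) \<Rightarrow> real \<Rightarrow> bool" where
  "one_sided_local_spectral_expander X n m lam \<longleftrightarrow>
     (\<forall>i\<in>{-1..n-2}. \<forall>\<tau>\<in>faces X i. link_mu X m \<tau> \<le> lam)"

end

theory Submission
  imports Defs
begin

text \<open>
  Let \<open>U\<close> send a \<open>k\<close>-cochain to the \<open>(k + 1)\<close>-cochain of its sums over facets, and let \<open>D\<close>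
  be the adjoint of \<open>U\<close>, the weighted average over cofaces.  Then the upper walk is \<open>D U / (k + 2)\<close>
  (\<open>upper_walk_eq_down_up\<close>), and both operators preserve cochains of weighted sum zero.  As \<open>U\<close> and
  \<open>D\<close> have the same norm on such cochains (\<open>norm_down_le_of_norm_up_le\<close>), a bound \<open>b\<^sub>k\<close> for the square
  of this norm gives the bound \<open>b\<^sub>k / (k + 2)\<close> for the upper walk, and the claim becomes
  \<open>b\<^sub>k = (k + 1) + (k + 1) (k + 2) lam / 2\<close>.

  The squared norm of \<open>U \<phi>\<close> is that of \<open>\<phi>\<close> plus the sum of \<open>m (\<tau> \<union> \<tau>') \<phi> \<tau> \<phi> \<tau>'\<close> over adjacent pairs
  of distinct \<open>k\<close>-simplices.  Such a pair meets in exactly one \<open>(k - 1)\<close>-simplex \<open>\<rho>\<close> and is an edge of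
  the link of \<open>\<rho>\<close>, so this sum is the sum over \<open>\<rho>\<close> of the quadratic forms of the non-lazy walks on the
  links, evaluated at the localisations \<open>v \<mapsto> \<phi> (\<rho> \<union> {v})\<close> of \<open>\<phi>\<close>.  The mean of a localisation is
  \<open>D \<phi> \<rho>\<close>, and on the part orthogonal to constants the form is at most \<open>lam\<close> times the squared norm.
  Since every \<open>k\<close>-simplex occurs in \<open>k + 1\<close> links, this yields (\<open>norm_up_le_norm_down\<close>)
  the inequality \<open>\<parallel>U \<phi>\<parallel>\<^sup>2 \<le> \<parallel>D \<phi>\<parallel>\<^sup>2 + (1 + (k + 1) lam) \<parallel>\<phi>\<parallel>\<^sup>2\<close>.  Here \<open>D\<close> starts in dimension \<open>k\<close>, so that its
  squared norm is at most \<open>b\<^sub>k\<^sub>-\<^sub>1\<close>.  The recursion \<open>b\<^sub>k = b\<^sub>k\<^sub>-\<^sub>1 + 1 + (k + 1) lam\<close> starts from \<open>0\<close> in dimension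
  \<open>-1\<close> and has the stated solution (\<open>norm_up_bound\<close>).

  That the second largest eigenvalue, read off from the multiset of all eigenvalues, bounds the walk on
  the orthogonal complement of the constants is the variational characterisation of eigenvalues.  It
  is proved by maximising the Rayleigh quotient over the unit sphere of that complement
  (\<open>rayleigh_le_second_eigenvalue\<close>).
\<close>

lemma sum_apply_fun: "(\<Sum>v\<in>A. F v) b = (\<Sum>v\<in>A. F v b :: real)"
  by (induction A rule: infinite_finite_induct) auto

section \<open>Finite-dimensional function spaces\<close>

lemma quadratic_nonneg_imp_linear_coeff_zero:
  fixes b c :: real
  assumes "\<And>t. 0 \<le> 2 * t * b + t\<^sup>2 * c"
  shows "b = 0"
proof (rule ccontr)
  assume "b \<noteq> 0"
  define d where "d = \<bar>c\<bar> + 1"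
  have d: "0 < d" "c < d" unfolding d_def by auto
  have "0 \<le> 2 * (- b / d) * b + (- b / d)\<^sup>2 * c" by (rule assms)
  also have "\<dots> = (b\<^sup>2 / d\<^sup>2) * (c - 2 * d)"
    using d by (simp add: field_simps power2_eq_square)
  also have "\<dots> < 0"
    using d \<open>b \<noteq> 0\<close> by (intro mult_pos_neg) auto
  finally show False by simp
qed

text \<open>Functions supported in \<open>V\<close> live in the function space on the whole type, so the compactness
  needed for a Rayleigh quotient argument is Tychonoff's theorem for a product of intervals, those
  outside \<open>V\<close> being the single point \<open>0\<close>.\<close>

lemma compact_functions_supported_box:
  fixes r :: "'b \<Rightarrow> real"
  shows "compact {f \<in> functions_on V. \<forall>v\<in>V. \<bar>f v\<bar> \<le> r v}"
proof -
  have "compactin (product_topology (\<lambda>_. euclidean) UNIV)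
      (PiE UNIV (\<lambda>v. if v \<in> V then {- r v..r v} else {0::real}))"
    by (simp add: compactin_PiE)
  moreover have "PiE UNIV (\<lambda>v. if v \<in> V then {- r v..r v} else {0::real})
      = {f \<in> functions_on V. \<forall>v\<in>V. \<bar>f v\<bar> \<le> r v}"
    by (fastforce simp: functions_on_def PiE_def Pi_def abs_le_iff split: if_splits)
  ultimately show ?thesis
    by (simp add: euclidean_product_topology)
qed

text \<open>The ambient function space is infinite-dimensional in general, so finiteness of dimensions has to
  come from the span of the finitely many unit functions.\<close>

lemma functions_on_subset_finite_span:
  assumes "finite V"
  obtains B where "finite B" "functions_on V \<subseteq> fun_vs.span B"
proof
  let ?e = "\<lambda>v b. if b = v then 1 else 0 :: real"
  show "finite (?e ` V)" using assms by simp
  show "functions_on V \<subseteq> fun_vs.span (?e ` V)"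
  proof
    fix f :: "'a \<Rightarrow> real"
    assume f: "f \<in> functions_on V"
    have "f = (\<Sum>v\<in>V. (\<lambda>b. f v * ?e v b))"
    proof
      fix b
      show "f b = (\<Sum>v\<in>V. (\<lambda>b. f v * ?e v b)) b"
        using f assms by (simp add: sum_apply_fun functions_on_def if_distrib cong: if_cong)
    qed
    also have "\<dots> \<in> fun_vs.span (?e ` V)"
      by (intro fun_vs.span_sum fun_vs.span_scale fun_vs.span_base) auto
    finally show "f \<in> fun_vs.span (?e ` V)" .
  qed
qed

lemma card_le_dim_if_independent_subset:
  assumes "finite V" "S \<subseteq> functions_on V" "A \<subseteq> S" "fun_vs.independent A"
  shows "finite A" "card A \<le> fun_vs.dim S"
proof -
  obtain C where C: "finite C" "functions_on V \<subseteq> fun_vs.span C"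
    using functions_on_subset_finite_span[OF assms(1)] .
  obtain B where B: "B \<subseteq> S" "fun_vs.independent B" "S \<subseteq> fun_vs.span B" "card B = fun_vs.dim S"
    using fun_vs.basis_exists by blast
  have "finite B"
    using fun_vs.independent_span_bound[OF C(1) B(2)] B(1) assms(2) C(2) by blast
  then have "finite A \<and> card A \<le> card B"
    using fun_vs.independent_span_bound[OF _ assms(4)] assms(3) B(3) by blast
  then show "finite A" "card A \<le> fun_vs.dim S" using B(4) by auto
qed

section \<open>The second eigenvalue of a weighted graph\<close>

text \<open>A finite graph with symmetric edge weights \<open>K\<close> whose row sums are the vertex weights \<open>w\<close>.  Its random
  walk is self-adjoint for the inner product weighted by \<open>w\<close>.\<close>

locale weighted_graph =
  fixes V :: "'b set" and w :: "'b \<Rightarrow> real" and K :: "'b \<Rightarrow> 'b \<Rightarrow> real"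
  assumes finite_V: "finite V"
    and w_pos: "v \<in> V \<Longrightarrow> 0 < w v"
    and K_sym: "u \<in> V \<Longrightarrow> v \<in> V \<Longrightarrow> K u v = K v u"
    and K_nonneg: "u \<in> V \<Longrightarrow> v \<in> V \<Longrightarrow> 0 \<le> K u v"
    and K_row: "v \<in> V \<Longrightarrow> (\<Sum>u\<in>V. K v u) = w v"
begin

definition ip :: "('b \<Rightarrow> real) \<Rightarrow> ('b \<Rightarrow> real) \<Rightarrow> real" where
  "ip f g = (\<Sum>v\<in>V. w v * f v * g v)"

definition walk :: "('b \<Rightarrow> real) \<Rightarrow> 'b \<Rightarrow> real" where
  "walk f = (\<lambda>v. if v \<in> V then (\<Sum>u\<in>V. K v u * f u) / w v else 0)"

abbreviation one :: "'b \<Rightarrow> real" where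
  "one \<equiv> indicator V"

lemma ip_commute: "ip f g = ip g f"
  by (simp add: ip_def mult_ac)

lemma ip_add_left: "ip (\<lambda>v. f v + g v) h = ip f h + ip g h"
  by (simp add: ip_def algebra_simps sum.distrib)

lemma ip_scale_left: "ip (\<lambda>v. a * f v) h = a * ip f h"
  by (simp add: ip_def algebra_simps sum_distrib_left)

lemma ip_one: "ip f one = (\<Sum>v\<in>V. w v * f v)"
  by (simp add: ip_def)

lemma ip_nonneg: "0 \<le> ip f f"
  unfolding ip_def using w_pos
  by (intro sum_nonneg) (metis less_imp_le mult.assoc mult_nonneg_nonneg zero_le_square)

lemma ip_self_eq_0:
  assumes "f \<in> functions_on V" "ip f f = 0"
  shows "f = (\<lambda>v. 0)"
proof
  fix v
  have nn: "0 \<le> w v * f v * f v" if "v \<in> V" for v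
    using w_pos[OF that] by (metis less_imp_le mult.assoc mult_nonneg_nonneg zero_le_square)
  show "f v = 0"
  proof (cases "v \<in> V")
    case True
    then have "w v * f v * f v = 0"
      using assms(2) sum_nonneg_eq_0_iff[OF finite_V nn] unfolding ip_def by auto
    then show ?thesis using w_pos[OF True] by simp
  qed (use assms(1) in \<open>auto simp: functions_on_def\<close>)
qed

lemma ip_walk: "ip f (walk g) = (\<Sum>v\<in>V. \<Sum>u\<in>V. K v u * f v * g u)"
proof -
  have "w v * f v * walk g v = (\<Sum>u\<in>V. K v u * f v * g u)" if "v \<in> V" for v
  proof -
    have "w v * f v * walk g v = f v * (\<Sum>u\<in>V. K v u * g u)"
      using w_pos[OF that] that by (simp add: walk_def)
    then show ?thesis by (simp add: sum_distrib_left mult_ac)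
  qed
  then show ?thesis by (simp add: ip_def)
qed

lemma walk_self_adjoint: "ip (walk f) g = ip f (walk g)"
proof -
  have "ip (walk f) g = (\<Sum>v\<in>V. \<Sum>u\<in>V. K v u * g v * f u)"
    by (simp add: ip_commute[of "walk f"] ip_walk)
  also have "\<dots> = (\<Sum>v\<in>V. \<Sum>u\<in>V. K v u * f v * g u)"
    by (subst sum.swap) (auto intro!: sum.cong simp: K_sym)
  finally show ?thesis by (simp add: ip_walk)
qed

lemma walk_in: "walk f \<in> functions_on V"
  by (auto simp: walk_def functions_on_def)

lemma walk_one: "walk one = one"
proof
  fix v
  show "walk one v = one v"
  proof (cases "v \<in> V")
    case True
    then have "(\<Sum>u\<in>V. K v u * one u) = w v" using K_row[OF True] by simp
    then show ?thesis using w_pos[OF True] True by (simp add: walk_def)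
  qed (simp add: walk_def)
qed

lemma walk_add: "walk (\<lambda>v. f v + g v) = (\<lambda>v. walk f v + walk g v)"
  by (auto simp: walk_def fun_eq_iff algebra_simps sum.distrib add_divide_distrib)

lemma walk_scale: "walk (\<lambda>v. a * f v) = (\<lambda>v. a * walk f v)"
  by (auto simp: walk_def fun_eq_iff sum_distrib_left mult_ac)

text \<open>The difference of the two sides is half of the Dirichlet form
  \<open>\<Sum>\<^sub>v \<Sum>\<^sub>u K v u * (f v - f u)\<^sup>2\<close>.  Hence no eigenvalue of the walk exceeds \<open>1\<close>.\<close>

lemma ip_walk_le: "ip f (walk f) \<le> ip f f"
proof -
  have row: "(\<Sum>v\<in>V. \<Sum>u\<in>V. K v u * (f v)\<^sup>2) = ip f f"
    by (simp add: ip_def K_row flip: sum_distrib_right) (simp add: power2_eq_square mult_ac)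
  then have col: "(\<Sum>v\<in>V. \<Sum>u\<in>V. K v u * (f u)\<^sup>2) = ip f f"
    by (subst sum.swap) (simp add: K_sym cong: sum.cong)
  have "0 \<le> (\<Sum>v\<in>V. \<Sum>u\<in>V. K v u * (f v - f u)\<^sup>2)"
    by (intro sum_nonneg mult_nonneg_nonneg K_nonneg) auto
  also have "\<dots> = (\<Sum>v\<in>V. \<Sum>u\<in>V. K v u * (f v)\<^sup>2) + (\<Sum>v\<in>V. \<Sum>u\<in>V. K v u * (f u)\<^sup>2)
      - 2 * (\<Sum>v\<in>V. \<Sum>u\<in>V. K v u * f v * f u)"
    by (simp add: power2_diff algebra_simps sum.distrib sum_subtractf sum_distrib_left)
  finally show ?thesis using row col by (simp add: ip_walk)
qed

lemma continuous_ip: "continuous_on UNIV (\<lambda>f. ip f f)"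
  unfolding ip_def by (intro continuous_intros continuous_on_product_coordinates)

lemma continuous_ip_walk: "continuous_on UNIV (\<lambda>f. ip f (walk f))"
  unfolding ip_walk by (intro continuous_intros continuous_on_product_coordinates)

lemma continuous_ip_one: "continuous_on UNIV (\<lambda>f. ip f one)"
  unfolding ip_def by (intro continuous_intros continuous_on_product_coordinates)

lemma compact_unit_sphere: "compact {f \<in> functions_on V. ip f one = 0 \<and> ip f f = 1}"
proof -
  have bound: "\<bar>f v\<bar> \<le> 1 + 1 / w v" if "v \<in> V" "ip f f = 1" for f v
  proof -
    have "w v * f v * f v \<le> ip f f"
      unfolding ip_def
      by (rule member_le_sum[OF that(1) _ finite_V])
         (metis DiffD1 less_imp_le mult.assoc mult_nonneg_nonneg w_pos zero_le_square)
    then have "(f v)\<^sup>2 \<le> 1 / w v"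
      using that w_pos[OF that(1)] by (simp add: field_simps power2_eq_square)
    also have "\<dots> \<le> (1 + 1 / w v)\<^sup>2"
    proof -
      have "y \<le> (1 + y)\<^sup>2" if "0 < y" for y :: real
        using that by (simp add: power2_sum add_nonneg_nonneg add_increasing2)
      then show ?thesis using w_pos[OF that(1)] by simp
    qed
    finally show ?thesis
      using w_pos[OF that(1)] by (simp add: abs_le_square_iff[symmetric])
  qed
  have "closed {f. ip f one = 0 \<and> ip f f = 1}"
    by (intro closed_Collect_conj closed_Collect_eq continuous_ip continuous_ip_one continuous_on_const)
  then have "compact ({f \<in> functions_on V. \<forall>v\<in>V. \<bar>f v\<bar> \<le> 1 + 1 / w v} \<inter> {f. ip f one = 0 \<and> ip f f = 1})"
    by (rule compact_Int_closed[OF compact_functions_supported_box])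
  also have "{f \<in> functions_on V. \<forall>v\<in>V. \<bar>f v\<bar> \<le> 1 + 1 / w v} \<inter> {f. ip f one = 0 \<and> ip f f = 1}
      = {f \<in> functions_on V. ip f one = 0 \<and> ip f f = 1}"
    using bound by auto
  finally show ?thesis .
qed

text \<open>Among unit vectors orthogonal to the constants choose \<open>g\<close> with the largest Rayleigh quotient \<open>x\<close>.  The
  form \<open>x * ip h h - ip h (walk h)\<close> is nonnegative on the orthogonal complement of the constants and
  vanishes at \<open>g\<close>.  Its first variation at \<open>g\<close> in the direction of the residual \<open>walk g - x * g\<close>, which
  again lies in that complement, is therefore zero; but it is minus twice the squared norm of the
  residual.\<close>

lemma maximal_eigenvector_orthogonal_to_constants:
  assumes f: "f \<in> functions_on V" "ip f one = 0" "f \<noteq> (\<lambda>v. 0)"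
  obtains g x where "g \<in> functions_on V" "ip g one = 0" "g \<noteq> (\<lambda>v. 0)"
    "walk g = (\<lambda>v. x * g v)"
    "\<And>h. h \<in> functions_on V \<Longrightarrow> ip h one = 0 \<Longrightarrow> ip h (walk h) \<le> x * ip h h"
proof -
  define S where "S = {f \<in> functions_on V. ip f one = 0}"
  have S_lin: "(\<lambda>v. a * p v + b * q v) \<in> S" if "p \<in> S" "q \<in> S" for p q a b
    using that by (auto simp: S_def functions_on_def ip_add_left ip_scale_left)
  have S_walk: "walk p \<in> S" if "p \<in> S" for p
    using that by (simp add: S_def walk_in walk_self_adjoint walk_one)
  let ?C = "{f \<in> functions_on V. ip f one = 0 \<and> ip f f = 1}"
  have normalise: "(\<lambda>v. (1 / sqrt (ip h h)) * h v) \<in> ?C" and pos: "0 < ip h h"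
    if "h \<in> S" "h \<noteq> (\<lambda>v. 0)" for h
  proof -
    show p: "0 < ip h h"
      using ip_nonneg[of h] ip_self_eq_0[of h] that by (auto simp: S_def less_le)
    let ?a = "1 / sqrt (ip h h)"
    have "ip (\<lambda>v. ?a * h v) (\<lambda>v. ?a * h v) = ?a * ?a * ip h h"
      by (simp only: ip_scale_left ip_commute[of h "\<lambda>v. _ * h v"])
    also have "\<dots> = 1" using p by simp
    finally show "(\<lambda>v. ?a * h v) \<in> ?C"
      using that by (auto simp: S_def functions_on_def ip_scale_left simp del: times_divide_eq_left)
  qed
  have "?C \<noteq> {}" using normalise[of f] f by (auto simp: S_def)
  then obtain g where g: "g \<in> ?C" and max: "\<And>h. h \<in> ?C \<Longrightarrow> ip h (walk h) \<le> ip g (walk g)"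
    using continuous_attains_sup[OF compact_unit_sphere _ continuous_on_subset[OF continuous_ip_walk]]
    by blast
  define x where "x = ip g (walk g)"
  have gS: "g \<in> S" using g by (auto simp: S_def)
  have rayleigh: "ip h (walk h) \<le> x * ip h h" if "h \<in> S" for h
  proof (cases "h = (\<lambda>v. 0)")
    case True
    then show ?thesis by (simp add: ip_def)
  next
    case False
    let ?a = "1 / sqrt (ip h h)"
    have "ip (\<lambda>v. ?a * h v) (walk (\<lambda>v. ?a * h v)) \<le> x"
      unfolding x_def by (rule max[OF normalise[OF that False]])
    also have "ip (\<lambda>v. ?a * h v) (walk (\<lambda>v. ?a * h v)) = ip h (walk h) / ip h h"
      using pos[OF that False]
      by (simp only: walk_scale ip_scale_left ip_commute[of h "\<lambda>v. _ * walk h v"])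
         (simp add: ip_commute)
    finally show ?thesis using pos[OF that False] by (simp add: field_simps)
  qed
  define r where "r = (\<lambda>v. 1 * walk g v + (- x) * g v)"
  have rS: "r \<in> S" unfolding r_def by (rule S_lin[OF S_walk[OF gS] gS])
  \<comment> \<open>the first variation in the direction of the residual itself\<close>
  have "- ip r r = 0"
  proof (rule quadratic_nonneg_imp_linear_coeff_zero)
    fix t
    let ?h = "\<lambda>v. 1 * g v + t * r v"
    have upper: "ip ?h (walk ?h) \<le> x * ip ?h ?h" by (rule rayleigh[OF S_lin[OF gS rS]])
    have Q: "ip ?h (walk ?h) = x + 2 * t * ip r (walk g) + t\<^sup>2 * ip r (walk r)"
    proof -
      have "ip ?h (walk ?h) = ip (walk g) ?h + t * ip (walk r) ?h"
        by (simp add: walk_add walk_scale ip_commute[of "\<lambda>v. g v + t * r v"] ip_add_left ip_scale_left)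
      also have "\<dots> = x + t * ip r (walk g) + t * (ip g (walk r) + t * ip r (walk r))"
        by (simp add: ip_commute[of "walk g"] ip_commute[of "walk r"] ip_add_left ip_scale_left x_def)
      also have "ip g (walk r) = ip r (walk g)"
        by (metis ip_commute walk_self_adjoint)
      finally show ?thesis by (simp add: algebra_simps power2_eq_square)
    qed
    have N: "ip ?h ?h = 1 + 2 * t * ip r g + t\<^sup>2 * ip r r"
    proof -
      have "ip ?h ?h = ip g ?h + t * ip r ?h"
        by (simp add: ip_add_left ip_scale_left)
      also have "\<dots> = 1 + t * ip r g + t * (ip g r + t * ip r r)"
        using g by (simp add: ip_commute[of g "\<lambda>v. g v + t * r v"] ip_commute[of r "\<lambda>v. g v + t * r v"]
            ip_add_left ip_scale_left)
      finally show ?thesis by (simp add: ip_commute[of g r] algebra_simps power2_eq_square)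
    qed
    have a: "ip r (walk g) = ip r r + x * ip r g"
    proof -
      have "ip r r = ip (walk g) r - x * ip g r"
        using ip_add_left[of "\<lambda>v. 1 * walk g v" "\<lambda>v. - x * g v" r]
          ip_scale_left[of 1 "walk g" r] ip_scale_left[of "- x" g r]
        unfolding r_def[symmetric] by simp
      then show ?thesis by (simp add: ip_commute[of r "walk g"] ip_commute[of r g])
    qed
    have "x + 2 * t * (ip r r + x * ip r g) + t\<^sup>2 * ip r (walk r)
        \<le> x * (1 + 2 * t * ip r g + t\<^sup>2 * ip r r)"
      using upper unfolding Q N a .
    then show "0 \<le> 2 * t * (- ip r r) + t\<^sup>2 * (x * ip r r - ip r (walk r))"
      by (simp add: algebra_simps)
  qed
  then have "r = (\<lambda>v. 0)" using rS ip_self_eq_0[of r] by (simp add: S_def)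
  then have "walk g v - x * g v = 0" for v
    by (simp add: r_def fun_eq_iff)
  then have "walk g = (\<lambda>v. x * g v)" by (simp add: fun_eq_iff)
  moreover have "g \<noteq> (\<lambda>v. 0)" using g by (auto simp: ip_def)
  ultimately show ?thesis
    using that[of g x] gS rayleigh by (auto simp: S_def)
qed

text \<open>Orthogonality gives independence without a finiteness assumption on the family, which is what
  allows to conclude afterwards that there are only finitely many eigenvalues.\<close>

lemma orthogonal_family_independent:
  assumes "A \<subseteq> functions_on V" "(\<lambda>v. 0) \<notin> A"
    and orth: "\<And>f g. f \<in> A \<Longrightarrow> g \<in> A \<Longrightarrow> f \<noteq> g \<Longrightarrow> ip f g = 0"
  shows "fun_vs.independent A"
  unfolding fun_vs.independent_explicit_finite_subsets
proof (intro allI impI ballI)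
  fix S u f
  assume S: "S \<subseteq> A" "finite S" and 0: "(\<Sum>v\<in>S. (\<lambda>x. u v * v x)) = 0" and f: "f \<in> S"
  have eq: "(\<Sum>v\<in>S. u v * v b) = 0" for b
    using fun_cong[OF 0, of b] by (simp add: sum_apply_fun)
  have "0 = (\<Sum>b\<in>V. w b * (\<Sum>v\<in>S. u v * v b) * f b)" by (simp add: eq)
  also have "\<dots> = (\<Sum>v\<in>S. u v * ip v f)"
    unfolding ip_def sum_distrib_left sum_distrib_right
    by (subst sum.swap) (simp add: mult_ac)
  also have "\<dots> = (\<Sum>v\<in>S. if v = f then u f * ip f f else 0)"
    using S(1) f by (intro sum.cong) (auto simp: orth subset_iff)
  also have "\<dots> = u f * ip f f" using S f by simp
  finally have "u f = 0 \<or> ip f f = 0" by simp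
  then show "u f = 0"
    using ip_self_eq_0[of f] S(1) f assms(1,2) by blast
qed

lemma eigenvectors_orthogonal:
  assumes "walk f = (\<lambda>v. x * f v)" "walk g = (\<lambda>v. y * g v)" "x \<noteq> y"
  shows "ip f g = 0"
proof -
  have "x * ip f g = y * ip f g"
    using walk_self_adjoint[of f g] unfolding assms(1,2)
    by (simp add: ip_scale_left ip_commute[of f "\<lambda>v. y * g v"]) (simp add: ip_commute)
  then show ?thesis using assms(3) by simp
qed

text \<open>A choice of one eigenvector for each eigenvalue is an orthogonal family, hence independent, in a
  finite-dimensional space.  Finiteness is essential for the multiset of eigenvalues, a sum over the
  set of all of them, to have its intended value.\<close>

lemma finite_eigenvalues: "finite (eigenvalues (functions_on V) walk)"
proof -
  let ?E = "eigenvalues (functions_on V) walk"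
  have "\<forall>x\<in>?E. \<exists>f. f \<in> functions_on V \<and> walk f = (\<lambda>v. x * f v) \<and> f \<noteq> (\<lambda>v. 0)"
    by (auto simp: eigenvalues_def eigenspace_def)
  from bchoice[OF this] obtain F where "\<forall>x\<in>?E. F x \<in> functions_on V \<and> walk (F x) = (\<lambda>v. x * F x v) \<and> F x \<noteq> (\<lambda>v. 0)"
    by blast
  then have F: "F x \<in> functions_on V" "walk (F x) = (\<lambda>v. x * F x v)" "F x \<noteq> (\<lambda>v. 0)"
    if "x \<in> ?E" for x
    using that by auto
  have orth: "ip (F x) (F y) = 0" if "x \<in> ?E" "y \<in> ?E" "x \<noteq> y" for x y
    using eigenvectors_orthogonal[OF F(2)[OF that(1)] F(2)[OF that(2)] that(3)] .
  have inj: "inj_on F ?E"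
  proof (rule inj_onI, rule ccontr)
    fix x y assume xy: "x \<in> ?E" "y \<in> ?E" "F x = F y" "x \<noteq> y"
    then have "ip (F x) (F x) = 0" using orth[OF xy(1,2,4)] by simp
    then show False using ip_self_eq_0[OF F(1)] F(3) xy(1) by blast
  qed
  have "fun_vs.independent (F ` ?E)"
  proof (rule orthogonal_family_independent)
    show "F ` ?E \<subseteq> functions_on V" using F(1) by blast
    show "(\<lambda>v. 0) \<notin> F ` ?E" using F(3) by (metis imageE)
    show "ip f g = 0" if "f \<in> F ` ?E" "g \<in> F ` ?E" "f \<noteq> g" for f g
      using that orth by blast
  qed
  then have "finite (F ` ?E)"
    using F(1) by (intro card_le_dim_if_independent_subset(1)[OF finite_V order_refl]) auto
  then show ?thesis using finite_imageD inj by blast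
qed

lemma count_eigenvalue_mset:
  "count (eigenvalue_mset (functions_on V) walk) x =
    (if x \<in> eigenvalues (functions_on V) walk
     then fun_vs.dim (eigenspace (functions_on V) walk x) else 0)"
  using finite_eigenvalues by (simp add: eigenvalue_mset_def count_sum)

lemma card_le_count_eigenvalue_mset:
  assumes "A \<subseteq> eigenspace (functions_on V) walk x" "fun_vs.independent A" "A \<noteq> {}"
  shows "card A \<le> count (eigenvalue_mset (functions_on V) walk) x"
proof -
  have "f \<noteq> (\<lambda>b. 0)" if "f \<in> A" for f
    using fun_vs.dependent_zero[of A] assms(2) that by (auto simp: zero_fun_def)
  then have "x \<in> eigenvalues (functions_on V) walk"
    using assms(1,3) by (fastforce simp: eigenvalues_def)
  moreover have "card A \<le> fun_vs.dim (eigenspace (functions_on V) walk x)"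
    by (rule card_le_dim_if_independent_subset(2)[OF finite_V _ assms(1,2)])
       (auto simp: eigenspace_def)
  ultimately show ?thesis by (simp add: count_eigenvalue_mset)
qed

lemma eigenvalue_le_1:
  assumes "x \<in> eigenvalues (functions_on V) walk"
  shows "x \<le> 1"
proof -
  obtain f where f: "f \<in> functions_on V" "walk f = (\<lambda>v. x * f v)" "f \<noteq> (\<lambda>v. 0)"
    using assms by (auto simp: eigenvalues_def eigenspace_def)
  have "x * ip f f \<le> ip f f"
    using ip_walk_le[of f] unfolding f(2) by (simp add: ip_commute[of f "\<lambda>v. x * f v"] ip_scale_left)
  moreover have "0 < ip f f"
    using ip_nonneg[of f] ip_self_eq_0[OF f(1)] f(3) by (auto simp: less_le)
  ultimately show ?thesis by simp
qed

text \<open>The maximal Rayleigh quotient \<open>x\<close> on the orthogonal complement of the constants is an eigenvalue, and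
  it survives the removal of one copy of the largest eigenvalue, which is \<open>1\<close>: if \<open>x = 1\<close>, the
  constant function and the eigenvector for \<open>x\<close> are independent, so that \<open>1\<close> has multiplicity at
  least two.  Hence \<open>x\<close> is at most the second largest eigenvalue.\<close>

lemma rayleigh_le_second_eigenvalue:
  assumes "f \<in> functions_on V" "ip f one = 0"
  shows "ip f (walk f) \<le> second_largest_eigenvalue (functions_on V) walk * ip f f"
proof (cases "f = (\<lambda>v. 0)")
  case True
  then show ?thesis by (simp add: ip_def)
next
  case False
  obtain g x where g: "g \<in> functions_on V" "ip g one = 0" "g \<noteq> (\<lambda>v. 0)" "walk g = (\<lambda>v. x * g v)"
    and bound: "\<And>h. h \<in> functions_on V \<Longrightarrow> ip h one = 0 \<Longrightarrow> ip h (walk h) \<le> x * ip h h"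
    using maximal_eigenvector_orthogonal_to_constants[OF assms False] by blast
  let ?M = "eigenvalue_mset (functions_on V) walk"
  have one_in: "one \<in> functions_on V" by (simp add: functions_on_def)
  have one_nz: "one \<noteq> (\<lambda>v. 0)"
    using False assms(1) by (force simp: functions_on_def fun_eq_iff indicator_def)
  have one_ev: "one \<in> eigenspace (functions_on V) walk 1"
    by (simp add: eigenspace_def one_in walk_one)
  have g_ev: "g \<in> eigenspace (functions_on V) walk x"
    by (simp add: eigenspace_def g)
  have ind_one: "fun_vs.independent {one}" and ind_g: "fun_vs.independent {g}"
    using one_nz g(3) by (simp_all add: zero_fun_def)
  have one_M: "1 \<in># ?M"
    using card_le_count_eigenvalue_mset[of "{one}" 1] one_ev ind_one
    by (simp flip: count_greater_zero_iff)
  have x_M: "x \<in># ?M"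
    using card_le_count_eigenvalue_mset[of "{g}" x] g_ev ind_g
    by (simp flip: count_greater_zero_iff)
  have le_1: "y \<le> 1" if "y \<in># ?M" for y
    using that eigenvalue_le_1[of y] by (simp flip: count_greater_zero_iff add: count_eigenvalue_mset split: if_splits)
  have Max: "Max_mset ?M = 1"
    using one_M le_1 by (intro Max_eqI) auto
  have "x \<in># ?M - {#1#}"
  proof (cases "x = 1")
    case True
    have "g \<noteq> one" using g(2) ip_self_eq_0[OF one_in] one_nz by auto
    moreover have "fun_vs.independent {g, one}"
      using g one_in one_nz by (intro orthogonal_family_independent) (auto simp: ip_commute)
    ultimately have "2 \<le> count ?M 1"
      using card_le_count_eigenvalue_mset[of "{g, one}" 1] g_ev one_ev True by simp
    then show ?thesis using True by (simp flip: count_greater_zero_iff)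
  next
    case False
    then show ?thesis using x_M by (simp add: in_diff_count)
  qed
  then have "x \<le> second_largest_eigenvalue (functions_on V) walk"
    by (simp add: second_largest_eigenvalue_def Let_def Max)
  then show ?thesis
    using bound[OF assms] ip_nonneg[of f] by (meson mult_right_mono order_trans)
qed

text \<open>Split \<open>f\<close> into its weighted mean \<open>c\<close> and a part \<open>h\<close> orthogonal to the constants.  The walk fixes
  constants, so the two parts do not interact, and the spectral bound applies to \<open>h\<close>.  Stating the
  mean by an equation for \<open>c\<close> avoids a case distinction on the total weight.\<close>

lemma walk_form_le_mean_plus:
  assumes lam: "0 \<le> lam" "second_largest_eigenvalue (functions_on V) walk \<le> lam"
    and c: "(\<Sum>v\<in>V. w v * f v) = c * (\<Sum>v\<in>V. w v)"
  shows "(\<Sum>v\<in>V. \<Sum>u\<in>V. K v u * f v * f u)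
    \<le> c\<^sup>2 * (\<Sum>v\<in>V. w v) + lam * (\<Sum>v\<in>V. w v * (f v)\<^sup>2)"
proof -
  define W where "W = (\<Sum>v\<in>V. w v)"
  define h where "h = (\<lambda>v. if v \<in> V then f v - c else 0)"
  have h_in: "h \<in> functions_on V" by (simp add: h_def functions_on_def)
  have wh: "(\<Sum>v\<in>V. w v * h v) = 0"
    using c by (simp add: h_def algebra_simps sum_subtractf sum_distrib_left cong: sum.cong)
  have hh: "ip h h = (\<Sum>v\<in>V. w v * (f v)\<^sup>2) - c\<^sup>2 * W"
  proof -
    have "ip h h = (\<Sum>v\<in>V. w v * (f v)\<^sup>2 - 2 * c * (w v * f v) + c\<^sup>2 * w v)"
      by (auto simp: ip_def h_def algebra_simps power2_eq_square intro!: sum.cong)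
    also have "\<dots> = (\<Sum>v\<in>V. w v * (f v)\<^sup>2) - 2 * c * (\<Sum>v\<in>V. w v * f v) + c\<^sup>2 * W"
      by (simp add: sum.distrib sum_subtractf sum_distrib_left W_def)
    finally show ?thesis using c by (simp add: W_def power2_eq_square)
  qed
  have W0: "0 \<le> W" unfolding W_def by (intro sum_nonneg less_imp_le w_pos)
  have "(\<Sum>v\<in>V. \<Sum>u\<in>V. K v u * f v * f u)
      = (\<Sum>v\<in>V. \<Sum>u\<in>V. K v u * h v * h u + c * (K v u * h v) + c * (K v u * h u) + c\<^sup>2 * K v u)"
    by (auto simp: h_def algebra_simps power2_eq_square intro!: sum.cong)
  also have "\<dots> = ip h (walk h) + c * (\<Sum>v\<in>V. \<Sum>u\<in>V. K v u * h v)
      + c * (\<Sum>v\<in>V. \<Sum>u\<in>V. K v u * h u) + c\<^sup>2 * W"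
    by (simp add: sum.distrib K_row ip_walk W_def flip: sum_distrib_left)
  also have "(\<Sum>v\<in>V. \<Sum>u\<in>V. K v u * h u) = (\<Sum>v\<in>V. \<Sum>u\<in>V. K v u * h v)"
    by (subst sum.swap) (simp add: K_sym cong: sum.cong)
  also have "(\<Sum>v\<in>V. \<Sum>u\<in>V. K v u * h v) = 0"
    using wh by (simp add: K_row flip: sum_distrib_right)
  finally have "(\<Sum>v\<in>V. \<Sum>u\<in>V. K v u * f v * f u) = ip h (walk h) + c\<^sup>2 * W" by simp
  moreover have "ip h (walk h) \<le> lam * ip h h"
    using rayleigh_le_second_eigenvalue[OF h_in] wh mult_right_mono[OF lam(2) ip_nonneg[of h]]
    by (simp add: ip_one)
  moreover have "lam * ip h h \<le> lam * (\<Sum>v\<in>V. w v * (f v)\<^sup>2)"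
    using hh W0 lam(1) by (intro mult_left_mono) auto
  ultimately show ?thesis by (simp add: W_def)
qed

end

section \<open>Walking up and down in a weighted complex\<close>

text \<open>Every facet is obtained by removing exactly one vertex.\<close>

lemma card_facets:
  assumes "finite_simplicial_complex X" "\<sigma> \<in> faces X (k + 1)"
  shows "card {\<tau>. \<tau> \<in> faces X k \<and> \<tau> \<subset> \<sigma>} = card \<sigma>"
proof -
  have fin: "finite \<sigma>" and card: "int (card \<sigma>) = k + 2" and sub: "\<And>\<tau>. \<tau> \<subseteq> \<sigma> \<Longrightarrow> \<tau> \<in> X"
    using assms by (auto simp: finite_simplicial_complex_def faces_def)
  have "{\<tau>. \<tau> \<in> faces X k \<and> \<tau> \<subset> \<sigma>} = (\<lambda>v. \<sigma> - {v}) ` \<sigma>"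
  proof (intro equalityI subsetI)
    fix \<tau> assume "\<tau> \<in> {\<tau>. \<tau> \<in> faces X k \<and> \<tau> \<subset> \<sigma>}"
    then have \<tau>: "\<tau> \<subset> \<sigma>" "int (card \<tau>) = k + 1" by (auto simp: faces_def)
    then have "card (\<sigma> - \<tau>) = 1"
      using card card_Diff_subset[of \<tau> \<sigma>] finite_subset[of \<tau> \<sigma>] fin by auto
    then obtain v where "\<sigma> - \<tau> = {v}" by (auto simp: card_1_singleton_iff)
    then have "v \<in> \<sigma>" "\<tau> = \<sigma> - {v}" using \<tau>(1) by auto
    then show "\<tau> \<in> (\<lambda>v. \<sigma> - {v}) ` \<sigma>" by blast
  next
    fix \<tau> assume "\<tau> \<in> (\<lambda>v. \<sigma> - {v}) ` \<sigma>"
    then obtain v where v: "v \<in> \<sigma>" "\<tau> = \<sigma> - {v}" by blast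
    have "card \<sigma> = Suc (card \<tau>)" unfolding v(2) by (rule card.remove[OF fin v(1)])
    then show "\<tau> \<in> {\<tau>. \<tau> \<in> faces X k \<and> \<tau> \<subset> \<sigma>}"
      using v sub card by (auto simp: faces_def)
  qed
  moreover have "inj_on (\<lambda>v. \<sigma> - {v}) \<sigma>" by (auto simp: inj_on_def)
  ultimately show ?thesis by (simp add: card_image)
qed

text \<open>The usual inequality for the functions rescaled by \<open>sqrt m\<close>.\<close>

lemma cochain_inner_Cauchy_Schwarz:
  assumes "\<And>\<sigma>. \<sigma> \<in> faces X k \<Longrightarrow> 0 \<le> m \<sigma>"
  shows "(cochain_inner X m k \<phi> \<psi>)\<^sup>2 \<le> cochain_inner X m k \<phi> \<phi> * cochain_inner X m k \<psi> \<psi>"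
proof -
  have split: "cochain_inner X m k \<alpha> \<beta> = (\<Sum>\<sigma>\<in>faces X k. (sqrt (m \<sigma>) * \<alpha> \<sigma>) * (sqrt (m \<sigma>) * \<beta> \<sigma>))"
    for \<alpha> \<beta>
    unfolding cochain_inner_def
  proof (rule sum.cong)
    fix \<sigma> assume "\<sigma> \<in> faces X k"
    then have "sqrt (m \<sigma>) * sqrt (m \<sigma>) = m \<sigma>" using assms by simp
    then show "m \<sigma> * \<alpha> \<sigma> * \<beta> \<sigma> = sqrt (m \<sigma>) * \<alpha> \<sigma> * (sqrt (m \<sigma>) * \<beta> \<sigma>)"
      by (metis mult.assoc mult.left_commute)
  qed simp
  show ?thesis
    unfolding split using Cauchy_Schwarz_ineq_sum[of "\<lambda>\<sigma>. sqrt (m \<sigma>) * \<phi> \<sigma>" "\<lambda>\<sigma>. sqrt (m \<sigma>) * \<psi> \<sigma>"]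
    by (simp add: power2_eq_square)
qed

locale weighted_complex =
  fixes X :: "'a set set" and n :: int and m :: "'a set \<Rightarrow> real"
  assumes pure: "pure_complex X n"
    and weight: "weight_function X n m"
begin

abbreviation inner :: "int \<Rightarrow> ('a set \<Rightarrow> real) \<Rightarrow> ('a set \<Rightarrow> real) \<Rightarrow> real" where
  "inner \<equiv> cochain_inner X m"

text \<open>The operators \<open>up\<close> and \<open>down\<close> pass between cochains of dimensions \<open>k\<close> and \<open>k + 1\<close>.  They are
  normalised so as to be adjoint to each other: \<open>up\<close> is a plain sum over facets, and only \<open>down\<close> is
  an average.\<close>

definition up :: "int \<Rightarrow> ('a set \<Rightarrow> real) \<Rightarrow> 'a set \<Rightarrow> real" where
  "up k \<phi> \<sigma> = (\<Sum>\<tau> | \<tau> \<in> faces X k \<and> \<tau> \<subset> \<sigma>. \<phi> \<tau>)"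

definition down :: "int \<Rightarrow> ('a set \<Rightarrow> real) \<Rightarrow> 'a set \<Rightarrow> real" where
  "down k \<psi> \<tau> = (\<Sum>\<sigma> | \<sigma> \<in> faces X (k + 1) \<and> \<tau> \<subset> \<sigma>. m \<sigma> * \<psi> \<sigma>) / m \<tau>"

text \<open>The weight of the coface spanned by two distinct \<open>k\<close>-simplices that differ in one vertex.\<close>

definition adj :: "int \<Rightarrow> 'a set \<Rightarrow> 'a set \<Rightarrow> real" where
  "adj k \<tau> \<tau>' = (if \<tau> \<noteq> \<tau>' \<and> \<tau> \<union> \<tau>' \<in> faces X (k + 1) then m (\<tau> \<union> \<tau>') else 0)"

lemma complex: "finite_simplicial_complex X"
  using pure by (simp add: pure_complex_def)

lemma finite_faces: "finite (faces X k)"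
  using complex by (simp add: finite_simplicial_complex_def faces_def)

lemma finite_face: "\<sigma> \<in> faces X k \<Longrightarrow> finite \<sigma>"
  using complex by (auto simp: finite_simplicial_complex_def faces_def)

lemma subface: "\<sigma> \<in> X \<Longrightarrow> \<tau> \<subseteq> \<sigma> \<Longrightarrow> \<tau> \<in> X"
  using complex by (auto simp: finite_simplicial_complex_def)

lemma m_pos: "\<sigma> \<in> faces X k \<Longrightarrow> -1 \<le> k \<Longrightarrow> k \<le> n \<Longrightarrow> 0 < m \<sigma>"
  using weight by (auto simp: weight_function_def)

lemma m_cofaces:
  "\<tau> \<in> faces X k \<Longrightarrow> -1 \<le> k \<Longrightarrow> k \<le> n - 1
    \<Longrightarrow> (\<Sum>\<sigma> | \<sigma> \<in> faces X (k + 1) \<and> \<tau> \<subset> \<sigma>. m \<sigma>) = m \<tau>"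
  using weight by (auto simp: weight_function_def)

lemma inner_nonneg: "-1 \<le> k \<Longrightarrow> k \<le> n \<Longrightarrow> 0 \<le> inner k \<phi> \<phi>"
  unfolding cochain_inner_def
  by (intro sum_nonneg) (metis less_imp_le m_pos mult.assoc mult_nonneg_nonneg zero_le_square)

text \<open>Both sides are sums over incident pairs of a \<open>k\<close>-simplex and a \<open>(k + 1)\<close>-simplex.\<close>

lemma up_down_adjoint:
  assumes "-1 \<le> k" "k \<le> n - 1"
  shows "inner (k + 1) (up k \<phi>) \<psi> = inner k \<phi> (down k \<psi>)"
proof -
  have "inner (k + 1) (up k \<phi>) \<psi>
      = (\<Sum>\<sigma>\<in>faces X (k + 1). \<Sum>\<tau> | \<tau> \<in> faces X k \<and> \<tau> \<subset> \<sigma>. \<phi> \<tau> * (m \<sigma> * \<psi> \<sigma>))"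
    by (simp add: cochain_inner_def up_def sum_distrib_left sum_distrib_right mult_ac)
  also have "\<dots> = (\<Sum>\<tau>\<in>faces X k. \<Sum>\<sigma> | \<sigma> \<in> faces X (k + 1) \<and> \<tau> \<subset> \<sigma>. \<phi> \<tau> * (m \<sigma> * \<psi> \<sigma>))"
    by (rule sum.swap_restrict) (rule finite_faces)+
  also have "\<dots> = (\<Sum>\<tau>\<in>faces X k. m \<tau> * \<phi> \<tau> * down k \<psi> \<tau>)"
  proof (rule sum.cong)
    fix \<tau> assume "\<tau> \<in> faces X k"
    then have "m \<tau> * down k \<psi> \<tau> = (\<Sum>\<sigma> | \<sigma> \<in> faces X (k + 1) \<and> \<tau> \<subset> \<sigma>. m \<sigma> * \<psi> \<sigma>)"
      using m_pos[of \<tau> k] assms by (simp add: down_def)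
    then show "(\<Sum>\<sigma> | \<sigma> \<in> faces X (k + 1) \<and> \<tau> \<subset> \<sigma>. \<phi> \<tau> * (m \<sigma> * \<psi> \<sigma>)) = m \<tau> * \<phi> \<tau> * down k \<psi> \<tau>"
      by (simp add: sum_distrib_left[symmetric] mult.left_commute mult.assoc)
  qed simp
  finally show ?thesis by (simp add: cochain_inner_def)
qed

lemma down_const:
  assumes "\<tau> \<in> faces X k" "-1 \<le> k" "k \<le> n - 1"
  shows "down k (\<lambda>_. 1) \<tau> = 1"
  using m_cofaces[OF assms] m_pos[of \<tau> k] assms by (simp add: down_def)

lemma up_const:
  assumes "\<sigma> \<in> faces X (k + 1)"
  shows "up k (\<lambda>_. 1) \<sigma> = of_int k + 2"
proof -
  have "real (card \<sigma>) = of_int (int (card \<sigma>))" by simp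
  also have "\<dots> = of_int k + 2" using assms by (simp add: faces_def)
  finally show ?thesis using card_facets[OF complex assms] by (simp add: up_def)
qed

text \<open>Being adjoint, the operators respect the pairing with constants; in particular both preserve the
  condition of having weighted sum zero.\<close>

lemma total_up:
  assumes "-1 \<le> k" "k \<le> n - 1"
  shows "(\<Sum>\<sigma>\<in>faces X (k + 1). m \<sigma> * up k \<phi> \<sigma>) = (\<Sum>\<tau>\<in>faces X k. m \<tau> * \<phi> \<tau>)"
  using up_down_adjoint[OF assms, of \<phi> "\<lambda>_. 1"] assms
  by (simp add: cochain_inner_def down_const)

lemma total_down:
  assumes "-1 \<le> k" "k \<le> n - 1"
  shows "(\<Sum>\<tau>\<in>faces X k. m \<tau> * down k \<psi> \<tau>)
    = (of_int k + 2) * (\<Sum>\<sigma>\<in>faces X (k + 1). m \<sigma> * \<psi> \<sigma>)"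
  using up_down_adjoint[OF assms, of "\<lambda>_. 1" \<psi>]
  by (simp add: cochain_inner_def up_const sum_distrib_left mult_ac)

text \<open>Two distinct \<open>k\<close>-simplices have at most one common coface of dimension \<open>k + 1\<close>, namely their
  union.\<close>

lemma sum_common_cofaces:
  assumes "\<tau> \<in> faces X k" "\<tau>' \<in> faces X k" "-1 \<le> k" "k \<le> n - 1"
  shows "(\<Sum>\<sigma> | \<sigma> \<in> faces X (k + 1) \<and> \<tau> \<subset> \<sigma> \<and> \<tau>' \<subset> \<sigma>. m \<sigma>)
    = (if \<tau> = \<tau>' then m \<tau> else 0) + adj k \<tau> \<tau>'"
proof (cases "\<tau> = \<tau>'")
  case True
  then show ?thesis using m_cofaces[OF assms(1,3,4)] by (simp add: adj_def)
next
  case False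
  have fin: "finite \<tau>" "finite \<tau>'" and card: "int (card \<tau>) = k + 1" "int (card \<tau>') = k + 1"
    using assms(1,2)[THEN finite_face] assms(1,2) by (auto simp: faces_def)
  have proper: "\<tau> \<subset> \<tau> \<union> \<tau>'" "\<tau>' \<subset> \<tau> \<union> \<tau>'"
  proof -
    have "\<not> \<tau>' \<subseteq> \<tau>" "\<not> \<tau> \<subseteq> \<tau>'"
      using False card card_subset_eq[OF fin(1), of \<tau>'] card_subset_eq[OF fin(2), of \<tau>] by auto
    then show "\<tau> \<subset> \<tau> \<union> \<tau>'" "\<tau>' \<subset> \<tau> \<union> \<tau>'" by auto
  qed
  have eq: "\<sigma> = \<tau> \<union> \<tau>'" if \<sigma>: "\<sigma> \<in> faces X (k + 1)" "\<tau> \<subset> \<sigma>" "\<tau>' \<subset> \<sigma>" for \<sigma>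
  proof -
    have "card \<tau> < card (\<tau> \<union> \<tau>')" by (intro psubset_card_mono proper) (use fin in auto)
    moreover have "int (card \<sigma>) = k + 2" using \<sigma>(1) by (simp add: faces_def)
    ultimately have "card \<sigma> \<le> card (\<tau> \<union> \<tau>')" using card by linarith
    then show ?thesis
      using card_seteq[OF finite_face[OF \<sigma>(1)], of "\<tau> \<union> \<tau>'"] \<sigma>(2,3) by blast
  qed
  have "{\<sigma>. \<sigma> \<in> faces X (k + 1) \<and> \<tau> \<subset> \<sigma> \<and> \<tau>' \<subset> \<sigma>}
      = {\<sigma>. \<sigma> = \<tau> \<union> \<tau>' \<and> \<tau> \<union> \<tau>' \<in> faces X (k + 1)}"
    using eq proper by blast
  also have "\<dots> = (if \<tau> \<union> \<tau>' \<in> faces X (k + 1) then {\<tau> \<union> \<tau>'} else {})"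
    by auto
  finally show ?thesis using False by (simp add: adj_def)
qed

lemma down_up:
  assumes "\<tau> \<in> faces X k" "-1 \<le> k" "k \<le> n - 1"
  shows "m \<tau> * down k (up k \<phi>) \<tau> = m \<tau> * \<phi> \<tau> + (\<Sum>\<tau>'\<in>faces X k. adj k \<tau> \<tau>' * \<phi> \<tau>')"
proof -
  have "m \<tau> * down k (up k \<phi>) \<tau> = (\<Sum>\<sigma> | \<sigma> \<in> faces X (k + 1) \<and> \<tau> \<subset> \<sigma>. m \<sigma> * up k \<phi> \<sigma>)"
    using m_pos[of \<tau> k] assms by (simp add: down_def)
  also have "\<dots>
      = (\<Sum>\<sigma>\<in>{\<sigma>. \<sigma> \<in> faces X (k + 1) \<and> \<tau> \<subset> \<sigma>}. \<Sum>\<tau>' | \<tau>' \<in> faces X k \<and> \<tau>' \<subset> \<sigma>. m \<sigma> * \<phi> \<tau>')"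
    by (simp add: up_def sum_distrib_left)
  also have "\<dots> = (\<Sum>\<tau>'\<in>faces X k. \<Sum>\<sigma> | \<sigma> \<in> {\<sigma>. \<sigma> \<in> faces X (k + 1) \<and> \<tau> \<subset> \<sigma>} \<and> \<tau>' \<subset> \<sigma>. m \<sigma> * \<phi> \<tau>')"
    by (rule sum.swap_restrict) (simp_all add: finite_faces)
  also have "\<dots> = (\<Sum>\<tau>'\<in>faces X k. ((if \<tau> = \<tau>' then m \<tau> else 0) + adj k \<tau> \<tau>') * \<phi> \<tau>')"
    using assms by (intro sum.cong refl) (simp add: sum_common_cofaces flip: sum_distrib_right)
  also have "\<dots> = (\<Sum>\<tau>'\<in>faces X k. (if \<tau> = \<tau>' then m \<tau> * \<phi> \<tau>' else 0) + adj k \<tau> \<tau>' * \<phi> \<tau>')"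
    by (intro sum.cong refl) (simp add: algebra_simps)
  also have "\<dots> = m \<tau> * \<phi> \<tau> + (\<Sum>\<tau>'\<in>faces X k. adj k \<tau> \<tau>' * \<phi> \<tau>')"
    using assms(1) finite_faces by (simp add: sum.distrib)
  finally show ?thesis .
qed

text \<open>This identity reduces the theorem to norm bounds for \<open>up\<close> and \<open>down\<close>.\<close>

lemma upper_walk_eq_down_up:
  assumes "\<tau> \<in> faces X k" "0 \<le> k" "k \<le> n - 1"
  shows "upper_walk X m k \<phi> \<tau> = down k (up k \<phi>) \<tau> / (of_int k + 2)"
proof -
  have pos: "0 < m \<tau>" "0 < real_of_int k + 2" using m_pos[OF assms(1)] assms by auto
  have "m \<tau> * (of_int k + 2) * upper_walk_kernel X m k \<tau> \<tau>' = (if \<tau> = \<tau>' then m \<tau> else 0) + adj k \<tau> \<tau>'" for \<tau>'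
    using pos by (simp add: upper_walk_kernel_def adj_def)
  then have "m \<tau> * (of_int k + 2) * upper_walk X m k \<phi> \<tau>
      = (\<Sum>\<tau>'\<in>faces X k. ((if \<tau> = \<tau>' then m \<tau> else 0) + adj k \<tau> \<tau>') * \<phi> \<tau>')"
    using assms(1) by (simp add: upper_walk_def sum_distrib_left flip: mult.assoc)
  also have "\<dots> = (\<Sum>\<tau>'\<in>faces X k. (if \<tau> = \<tau>' then m \<tau> * \<phi> \<tau>' else 0) + adj k \<tau> \<tau>' * \<phi> \<tau>')"
    by (intro sum.cong refl) (simp add: algebra_simps)
  also have "\<dots> = m \<tau> * down k (up k \<phi>) \<tau>"
    using assms finite_faces by (simp add: sum.distrib down_up)
  finally have "(of_int k + 2) * upper_walk X m k \<phi> \<tau> = down k (up k \<phi>) \<tau>"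
    using pos(1) by (simp only: mult.assoc) simp
  then show ?thesis using pos(2) by (metis less_irrefl nonzero_mult_div_cancel_left)
qed

lemma inner_up_up:
  assumes "-1 \<le> k" "k \<le> n - 1"
  shows "inner (k + 1) (up k \<phi>) (up k \<phi>)
    = inner k \<phi> \<phi> + (\<Sum>\<tau>\<in>faces X k. \<Sum>\<tau>'\<in>faces X k. adj k \<tau> \<tau>' * \<phi> \<tau> * \<phi> \<tau>')"
proof -
  have "m \<tau> * \<phi> \<tau> * down k (up k \<phi>) \<tau>
      = m \<tau> * \<phi> \<tau> * \<phi> \<tau> + (\<Sum>\<tau>'\<in>faces X k. adj k \<tau> \<tau>' * \<phi> \<tau> * \<phi> \<tau>')"
    if "\<tau> \<in> faces X k" for \<tau>
  proof -
    have "m \<tau> * \<phi> \<tau> * down k (up k \<phi>) \<tau> = \<phi> \<tau> * (m \<tau> * down k (up k \<phi>) \<tau>)" by simp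
    then show ?thesis
      unfolding down_up[OF that assms] by (simp add: algebra_simps sum_distrib_left)
  qed
  then show ?thesis
    unfolding up_down_adjoint[OF assms] by (simp add: cochain_inner_def sum.distrib)
qed

section \<open>Localisation to links\<close>

lemma vertices_link: "vertices (link X \<rho>) = {v. v \<notin> \<rho> \<and> insert v \<rho> \<in> X}"
  using subface by (auto simp: vertices_def link_def)

lemma finite_vertices_link: "finite (vertices (link X \<rho>))"
proof (rule finite_subset)
  show "vertices (link X \<rho>) \<subseteq> \<Union>X" by (auto simp: vertices_link)
  show "finite (\<Union>X)" using complex by (auto simp: finite_simplicial_complex_def)
qed

text \<open>Functions on the vertices of a link are thereby the same as functions on the cofaces of the simplex.
  All sums over links are rewritten in this way.\<close>

lemma bij_link_vertices_cofaces:
  assumes "\<rho> \<in> faces X k"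
  shows "bij_betw (\<lambda>v. insert v \<rho>) (vertices (link X \<rho>)) {\<tau>. \<tau> \<in> faces X (k + 1) \<and> \<rho> \<subset> \<tau>}"
proof (rule bij_betw_imageI)
  show "inj_on (\<lambda>v. insert v \<rho>) (vertices (link X \<rho>))"
    by (auto simp: inj_on_def vertices_link)
  have fin: "finite \<rho>" and card: "int (card \<rho>) = k + 1"
    using finite_face[OF assms] assms by (auto simp: faces_def)
  show "(\<lambda>v. insert v \<rho>) ` vertices (link X \<rho>) = {\<tau>. \<tau> \<in> faces X (k + 1) \<and> \<rho> \<subset> \<tau>}"
  proof (intro equalityI subsetI)
    fix \<tau> assume "\<tau> \<in> {\<tau>. \<tau> \<in> faces X (k + 1) \<and> \<rho> \<subset> \<tau>}"
    then have \<tau>: "\<tau> \<in> X" "\<rho> \<subset> \<tau>" "int (card \<tau>) = k + 2" by (auto simp: faces_def)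
    then have "card (\<tau> - \<rho>) = 1" using card card_Diff_subset[OF fin, of \<tau>] by auto
    then obtain v where "\<tau> - \<rho> = {v}" by (auto simp: card_1_singleton_iff)
    then have "v \<notin> \<rho>" "\<tau> = insert v \<rho>" using \<tau>(2) by auto
    then show "\<tau> \<in> (\<lambda>v. insert v \<rho>) ` vertices (link X \<rho>)"
      using \<tau>(1) by (auto simp: vertices_link)
  qed (use fin card in \<open>auto simp: vertices_link faces_def\<close>)
qed

lemma sum_link_vertices:
  assumes "\<rho> \<in> faces X k"
  shows "(\<Sum>v\<in>vertices (link X \<rho>). g (insert v \<rho>)) = (\<Sum>\<tau> | \<tau> \<in> faces X (k + 1) \<and> \<rho> \<subset> \<tau>. g \<tau>)"
  by (rule sum.reindex_bij_betw[OF bij_link_vertices_cofaces[OF assms]])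

lemma link_face:
  assumes "\<rho> \<in> faces X k" "v \<in> vertices (link X \<rho>)"
  shows "insert v \<rho> \<in> faces X (k + 1)"
  using bij_betw_apply[OF bij_link_vertices_cofaces[OF assms(1)] assms(2)] by simp

text \<open>A pair of vertices is an edge of the link of \<open>\<rho>\<close> exactly if the second vertex lies in the link of
  \<open>\<rho>\<close> extended by the first one.\<close>

lemma adj_link:
  assumes "\<rho> \<in> faces X (k - 1)" "v \<in> vertices (link X \<rho>)" "u \<in> vertices (link X \<rho>)"
  shows "adj k (insert v \<rho>) (insert u \<rho>)
    = (if u \<in> vertices (link X (insert v \<rho>)) then m (insert u (insert v \<rho>)) else 0)"
proof -
  have un: "insert v \<rho> \<union> insert u \<rho> = insert u (insert v \<rho>)" by auto
  have "insert v \<rho> \<noteq> insert u \<rho> \<longleftrightarrow> u \<noteq> v" using assms(2,3) by (auto simp: vertices_link)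
  moreover have "insert u (insert v \<rho>) \<in> faces X (k + 1) \<longleftrightarrow> insert u (insert v \<rho>) \<in> X" if "u \<noteq> v"
    using assms finite_face[OF assms(1)] that by (auto simp: vertices_link faces_def)
  ultimately show ?thesis
    using assms(2,3) unfolding adj_def un by (auto simp: vertices_link)
qed

text \<open>The row sums come out right because the weights are balanced at the simplex \<open>insert v \<rho>\<close>, whose
  cofaces correspond to the neighbours of \<open>v\<close> in the link of \<open>\<rho>\<close>.\<close>

lemma link_weighted_graph:
  assumes "\<rho> \<in> faces X (k - 1)" "0 \<le> k" "k \<le> n - 1"
  shows "weighted_graph (vertices (link X \<rho>)) (\<lambda>v. m (insert v \<rho>)) (\<lambda>v u. adj k (insert v \<rho>) (insert u \<rho>))"
proof
  show "finite (vertices (link X \<rho>))" by (rule finite_vertices_link)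
  show "0 < m (insert v \<rho>)" if "v \<in> vertices (link X \<rho>)" for v
    using m_pos[of "insert v \<rho>" k] link_face[OF assms(1) that] assms(2,3) by simp
  show "adj k (insert u \<rho>) (insert v \<rho>) = adj k (insert v \<rho>) (insert u \<rho>)" for u v
    unfolding adj_def by (metis sup_commute)
  show "0 \<le> adj k (insert u \<rho>) (insert v \<rho>)" for u v
    using m_pos[of "insert u \<rho> \<union> insert v \<rho>" "k + 1"] assms(2,3)
    by (auto simp: adj_def)
  show "(\<Sum>u\<in>vertices (link X \<rho>). adj k (insert v \<rho>) (insert u \<rho>)) = m (insert v \<rho>)"
    if v: "v \<in> vertices (link X \<rho>)" for v
  proof -
    have \<tau>: "insert v \<rho> \<in> faces X k" using link_face[OF assms(1) v] by simp
    have sub: "vertices (link X (insert v \<rho>)) \<subseteq> vertices (link X \<rho>)"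
      by (auto simp: vertices_link intro: subface)
    have "(\<Sum>u\<in>vertices (link X \<rho>). adj k (insert v \<rho>) (insert u \<rho>))
        = (\<Sum>u\<in>vertices (link X (insert v \<rho>)). m (insert u (insert v \<rho>)))"
      using sub by (intro sum.mono_neutral_cong_right finite_vertices_link)
        (auto simp: adj_link[OF assms(1) v])
    also have "\<dots> = m (insert v \<rho>)"
      using sum_link_vertices[OF \<tau>, of m] m_cofaces[OF \<tau>] assms(2,3) by simp
    finally show ?thesis .
  qed
qed

lemma nonlazy_walk_link:
  assumes "\<rho> \<in> faces X (k - 1)" "0 \<le> k" "k \<le> n - 1"
  shows "nonlazy_walk (link X \<rho>) (link_weight m \<rho>)
    = weighted_graph.walk (vertices (link X \<rho>)) (\<lambda>v. m (insert v \<rho>)) (\<lambda>v u. adj k (insert v \<rho>) (insert u \<rho>))"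
proof (intro ext)
  fix f v
  interpret G: weighted_graph "vertices (link X \<rho>)" "\<lambda>v. m (insert v \<rho>)"
    "\<lambda>v u. adj k (insert v \<rho>) (insert u \<rho>)"
    by (rule link_weighted_graph[OF assms])
  show "nonlazy_walk (link X \<rho>) (link_weight m \<rho>) f v = G.walk f v"
  proof (cases "v \<in> vertices (link X \<rho>)")
    case True
    have edge: "{v, u} \<in> faces (link X \<rho>) 1
        \<longleftrightarrow> u \<in> vertices (link X \<rho>) \<and> u \<in> vertices (link X (insert v \<rho>))" for u
      using True subface[of "insert u (insert v \<rho>)" "{v, u}"]
        subface[of "insert u (insert v \<rho>)" "insert u \<rho>"]
      unfolding vertices_link
      by (auto simp: link_def faces_def insert_commute card_insert_if)
    have "(\<Sum>u | {v, u} \<in> faces (link X \<rho>) 1. m (\<rho> \<union> {v, u}) / m (\<rho> \<union> {v}) * f u)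
        = (\<Sum>u\<in>vertices (link X \<rho>). adj k (insert v \<rho>) (insert u \<rho>) / m (insert v \<rho>) * f u)"
      unfolding edge
      by (intro sum.mono_neutral_cong_left finite_vertices_link)
        (auto simp: adj_link[OF assms(1) True] insert_commute)
    then show ?thesis
      using True by (simp add: nonlazy_walk_def G.walk_def link_weight_def sum_divide_distrib)
  qed (simp add: nonlazy_walk_def G.walk_def)
qed

text \<open>The spectral bound for the link of \<open>\<rho>\<close>, applied to the localisation \<open>v \<mapsto> \<phi> (insert v \<rho>)\<close>, whose
  weighted mean is \<open>down (k - 1) \<phi> \<rho>\<close>.\<close>

lemma link_form_bound:
  assumes "\<rho> \<in> faces X (k - 1)" "0 \<le> k" "k \<le> n - 1"
    and lam: "0 \<le> lam" "link_mu X m \<rho> \<le> lam"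
  defines "C \<equiv> {\<tau>. \<tau> \<in> faces X k \<and> \<rho> \<subset> \<tau>}"
  shows "(\<Sum>\<tau>\<in>C. \<Sum>\<tau>'\<in>C. adj k \<tau> \<tau>' * \<phi> \<tau> * \<phi> \<tau>')
    \<le> m \<rho> * (down (k - 1) \<phi> \<rho>)\<^sup>2 + lam * (\<Sum>\<tau>\<in>C. m \<tau> * (\<phi> \<tau>)\<^sup>2)"
proof -
  interpret G: weighted_graph "vertices (link X \<rho>)" "\<lambda>v. m (insert v \<rho>)"
    "\<lambda>v u. adj k (insert v \<rho>) (insert u \<rho>)"
    by (rule link_weighted_graph[OF assms(1-3)])
  have reindex: "(\<Sum>v\<in>vertices (link X \<rho>). g (insert v \<rho>)) = (\<Sum>\<tau>\<in>C. g \<tau>)" for g :: "'a set \<Rightarrow> real"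
    using sum_link_vertices[OF assms(1), of g] by (simp add: C_def)
  have total: "(\<Sum>\<tau>\<in>C. m \<tau>) = m \<rho>"
    using m_cofaces[OF assms(1)] assms(2,3) by (simp add: C_def)
  have mean: "(\<Sum>\<tau>\<in>C. m \<tau> * \<phi> \<tau>) = down (k - 1) \<phi> \<rho> * m \<rho>"
    using m_pos[OF assms(1)] assms(2,3) by (simp add: C_def down_def)
  have "(\<Sum>v\<in>vertices (link X \<rho>). \<Sum>u\<in>vertices (link X \<rho>).
        adj k (insert v \<rho>) (insert u \<rho>) * \<phi> (insert v \<rho>) * \<phi> (insert u \<rho>))
      \<le> (down (k - 1) \<phi> \<rho>)\<^sup>2 * (\<Sum>v\<in>vertices (link X \<rho>). m (insert v \<rho>))
        + lam * (\<Sum>v\<in>vertices (link X \<rho>). m (insert v \<rho>) * (\<phi> (insert v \<rho>))\<^sup>2)"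
  proof (rule G.walk_form_le_mean_plus[OF lam(1)])
    show "second_largest_eigenvalue (functions_on (vertices (link X \<rho>))) G.walk \<le> lam"
      using lam(2) by (simp add: link_mu_def nonlazy_walk_link[OF assms(1-3)])
    show "(\<Sum>v\<in>vertices (link X \<rho>). m (insert v \<rho>) * \<phi> (insert v \<rho>))
        = down (k - 1) \<phi> \<rho> * (\<Sum>v\<in>vertices (link X \<rho>). m (insert v \<rho>))"
      using reindex[of "\<lambda>\<tau>. m \<tau> * \<phi> \<tau>"] reindex[of m] by (simp add: mean total)
  qed
  then show ?thesis
    using reindex[of m] reindex[of "\<lambda>\<tau>. m \<tau> * (\<phi> \<tau>)\<^sup>2"]
      reindex[of "\<lambda>\<tau>'. adj k _ \<tau>' * \<phi> _ * \<phi> \<tau>'"]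
      reindex[of "\<lambda>\<tau>. \<Sum>\<tau>'\<in>C. adj k \<tau> \<tau>' * \<phi> \<tau> * \<phi> \<tau>'"]
    by (simp add: total mult.commute)
qed

section \<open>From local to global\<close>

text \<open>By the count of elements, two \<open>k\<close>-simplices whose union has one more vertex meet in a
  \<open>(k - 1)\<close>-simplex.\<close>

lemma unique_common_facet:
  assumes "\<tau> \<in> faces X k" "\<tau>' \<in> faces X k" "\<tau> \<noteq> \<tau>'" "\<tau> \<union> \<tau>' \<in> faces X (k + 1)"
  shows "{\<rho> \<in> faces X (k - 1). \<rho> \<subset> \<tau> \<and> \<rho> \<subset> \<tau>'} = {\<tau> \<inter> \<tau>'}"
proof -
  have fin: "finite \<tau>" "finite \<tau>'" using assms(1,2)[THEN finite_face] by auto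
  have card: "int (card (\<tau> \<inter> \<tau>')) = k"
    using card_Un_Int[OF fin] assms by (simp add: faces_def)
  have "\<tau> \<inter> \<tau>' \<in> faces X (k - 1)"
    using card subface[of \<tau> "\<tau> \<inter> \<tau>'"] assms(1) by (auto simp: faces_def)
  moreover have "\<tau> \<inter> \<tau>' \<subset> \<tau>" "\<tau> \<inter> \<tau>' \<subset> \<tau>'"
  proof -
    have "card (\<tau> \<inter> \<tau>') \<noteq> card \<tau>" "card (\<tau> \<inter> \<tau>') \<noteq> card \<tau>'"
      using card assms(1,2) by (simp_all add: faces_def)
    then show "\<tau> \<inter> \<tau>' \<subset> \<tau>" "\<tau> \<inter> \<tau>' \<subset> \<tau>'"
      by (metis inf_le1 psubsetI, metis inf_le2 psubsetI)
  qed
  moreover have "\<rho> = \<tau> \<inter> \<tau>'" if "\<rho> \<in> faces X (k - 1)" "\<rho> \<subset> \<tau>" "\<rho> \<subset> \<tau>'" for \<rho>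
    using that card card_seteq[of "\<tau> \<inter> \<tau>'" \<rho>] fin by (auto simp: faces_def)
  ultimately show ?thesis by blast
qed

text \<open>Each adjacent pair of \<open>k\<close>-simplices is seen in the link of exactly one \<open>(k - 1)\<close>-simplex, so the edge
  forms of the links add up to the off-diagonal part of the squared norm of \<open>up k \<phi>\<close>.\<close>

lemma sum_links_adj:
  "(\<Sum>\<rho>\<in>faces X (k - 1). \<Sum>\<tau>\<in>{\<tau>. \<tau> \<in> faces X k \<and> \<rho> \<subset> \<tau>}. \<Sum>\<tau>'\<in>{\<tau>. \<tau> \<in> faces X k \<and> \<rho> \<subset> \<tau>}.
      adj k \<tau> \<tau>' * \<phi> \<tau> * \<phi> \<tau>')
    = (\<Sum>\<tau>\<in>faces X k. \<Sum>\<tau>'\<in>faces X k. adj k \<tau> \<tau>' * \<phi> \<tau> * \<phi> \<tau>')"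
proof -
  have "(\<Sum>\<rho>\<in>faces X (k - 1). \<Sum>\<tau> | \<tau> \<in> faces X k \<and> \<rho> \<subset> \<tau>. \<Sum>\<tau>' | \<tau>' \<in> faces X k \<and> \<rho> \<subset> \<tau>'.
        adj k \<tau> \<tau>' * \<phi> \<tau> * \<phi> \<tau>')
      = (\<Sum>\<tau>\<in>faces X k. \<Sum>\<rho>\<in>{\<rho>. \<rho> \<in> faces X (k - 1) \<and> \<rho> \<subset> \<tau>}. \<Sum>\<tau>' | \<tau>' \<in> faces X k \<and> \<rho> \<subset> \<tau>'.
        adj k \<tau> \<tau>' * \<phi> \<tau> * \<phi> \<tau>')"
    by (rule sum.swap_restrict) (rule finite_faces)+
  also have "\<dots> = (\<Sum>\<tau>\<in>faces X k. \<Sum>\<tau>'\<in>faces X k.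
      \<Sum>\<rho> | \<rho> \<in> {\<rho>. \<rho> \<in> faces X (k - 1) \<and> \<rho> \<subset> \<tau>} \<and> \<rho> \<subset> \<tau>'. adj k \<tau> \<tau>' * \<phi> \<tau> * \<phi> \<tau>')"
    by (intro sum.cong refl sum.swap_restrict) (simp_all add: finite_faces)
  also have "\<dots> = (\<Sum>\<tau>\<in>faces X k. \<Sum>\<tau>'\<in>faces X k. adj k \<tau> \<tau>' * \<phi> \<tau> * \<phi> \<tau>')"
  proof (intro sum.cong refl)
    fix \<tau> \<tau>' assume *: "\<tau> \<in> faces X k" "\<tau>' \<in> faces X k"
    show "(\<Sum>\<rho> | \<rho> \<in> {\<rho>. \<rho> \<in> faces X (k - 1) \<and> \<rho> \<subset> \<tau>} \<and> \<rho> \<subset> \<tau>'. adj k \<tau> \<tau>' * \<phi> \<tau> * \<phi> \<tau>')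
        = adj k \<tau> \<tau>' * \<phi> \<tau> * \<phi> \<tau>'"
    proof (cases "\<tau> \<noteq> \<tau>' \<and> \<tau> \<union> \<tau>' \<in> faces X (k + 1)")
      case True
      then show ?thesis using unique_common_facet[OF *] by (simp add: conj_assoc)
    qed (auto simp: adj_def)
  qed
  finally show ?thesis .
qed

text \<open>Each \<open>k\<close>-simplex has \<open>k + 1\<close> facets and therefore appears in \<open>k + 1\<close> links.\<close>

lemma sum_links_norm:
  "(\<Sum>\<rho>\<in>faces X (k - 1). \<Sum>\<tau> | \<tau> \<in> faces X k \<and> \<rho> \<subset> \<tau>. m \<tau> * (\<phi> \<tau>)\<^sup>2) = (of_int k + 1) * inner k \<phi> \<phi>"
proof -
  have "(\<Sum>\<rho>\<in>faces X (k - 1). \<Sum>\<tau> | \<tau> \<in> faces X k \<and> \<rho> \<subset> \<tau>. m \<tau> * (\<phi> \<tau>)\<^sup>2)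
      = (\<Sum>\<tau>\<in>faces X k. \<Sum>\<rho> | \<rho> \<in> faces X (k - 1) \<and> \<rho> \<subset> \<tau>. m \<tau> * (\<phi> \<tau>)\<^sup>2)"
    by (rule sum.swap_restrict) (rule finite_faces)+
  also have "\<dots> = (\<Sum>\<tau>\<in>faces X k. up (k - 1) (\<lambda>_. 1) \<tau> * (m \<tau> * (\<phi> \<tau>)\<^sup>2))"
    by (simp add: up_def)
  also have "\<dots> = (of_int k + 1) * inner k \<phi> \<phi>"
    using up_const[of _ "k - 1"]
    by (simp add: cochain_inner_def sum_distrib_left power2_eq_square ac_simps)
  finally show ?thesis .
qed

text \<open>Summing the bounds for the links over all \<open>(k - 1)\<close>-simplices turns the means of the localisations
  into the squared norm of \<open>down (k - 1) \<phi>\<close>.  This is the step from local to global: it bounds the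
  operator going up from dimension \<open>k\<close> by the one going down from dimension \<open>k\<close>.\<close>

lemma norm_up_le_norm_down:
  assumes "one_sided_local_spectral_expander X n m lam" "0 \<le> lam" "0 \<le> k" "k \<le> n - 1"
  shows "inner (k + 1) (up k \<phi>) (up k \<phi>)
    \<le> inner (k - 1) (down (k - 1) \<phi>) (down (k - 1) \<phi>) + (1 + (of_int k + 1) * lam) * inner k \<phi> \<phi>"
proof -
  have "(\<Sum>\<tau>\<in>faces X k. \<Sum>\<tau>'\<in>faces X k. adj k \<tau> \<tau>' * \<phi> \<tau> * \<phi> \<tau>')
      \<le> (\<Sum>\<rho>\<in>faces X (k - 1). m \<rho> * (down (k - 1) \<phi> \<rho>)\<^sup>2
          + lam * (\<Sum>\<tau> | \<tau> \<in> faces X k \<and> \<rho> \<subset> \<tau>. m \<tau> * (\<phi> \<tau>)\<^sup>2))"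
    unfolding sum_links_adj[symmetric]
    using assms by (intro sum_mono link_form_bound) (auto simp: one_sided_local_spectral_expander_def)
  also have "\<dots> = inner (k - 1) (down (k - 1) \<phi>) (down (k - 1) \<phi>) + lam * ((of_int k + 1) * inner k \<phi> \<phi>)"
    by (simp add: sum.distrib sum_links_norm flip: sum_distrib_left)
       (simp add: cochain_inner_def power2_eq_square mult_ac)
  finally show ?thesis
    using inner_up_up[of k \<phi>] assms by (simp add: algebra_simps)
qed

text \<open>An operator and its adjoint have the same norm.  With \<open>d\<close> the squared norm of \<open>down k \<psi>\<close>,
  adjointness and Cauchy--Schwarz give \<open>d\<^sup>2 \<le> (b * d) * inner (k + 1) \<psi> \<psi>\<close>.\<close>

lemma norm_down_le_of_norm_up_le:
  assumes k: "-1 \<le> k" "k \<le> n - 1" and b: "0 \<le> b"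
    and up: "\<And>\<phi>. (\<Sum>\<tau>\<in>faces X k. m \<tau> * \<phi> \<tau>) = 0
      \<Longrightarrow> inner (k + 1) (up k \<phi>) (up k \<phi>) \<le> b * inner k \<phi> \<phi>"
    and \<psi>: "(\<Sum>\<sigma>\<in>faces X (k + 1). m \<sigma> * \<psi> \<sigma>) = 0"
  shows "inner k (down k \<psi>) (down k \<psi>) \<le> b * inner (k + 1) \<psi> \<psi>"
proof -
  define d where "d = inner k (down k \<psi>) (down k \<psi>)"
  define c where "c = inner (k + 1) \<psi> \<psi>"
  have nonneg: "0 \<le> d" "0 \<le> c" unfolding d_def c_def using k by (auto intro!: inner_nonneg)
  have "d\<^sup>2 = (inner (k + 1) (up k (down k \<psi>)) \<psi>)\<^sup>2"
    unfolding d_def up_down_adjoint[OF k] ..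
  also have "\<dots> \<le> inner (k + 1) (up k (down k \<psi>)) (up k (down k \<psi>)) * c"
    unfolding c_def using m_pos[of _ "k + 1"] k
    by (intro cochain_inner_Cauchy_Schwarz less_imp_le) auto
  also have "\<dots> \<le> b * d * c"
    unfolding d_def using nonneg(2) \<psi> total_down[OF k, of \<psi>]
    by (intro mult_right_mono up) auto
  finally have "d * d \<le> d * (b * c)" by (simp add: power2_eq_square mult_ac)
  then show ?thesis
    using nonneg b unfolding d_def[symmetric] c_def[symmetric]
    by (cases "d = 0") auto
qed

text \<open>Write \<open>b\<^sub>k\<close> for the constant.  The two preceding lemmas give \<open>b\<^sub>k = b\<^sub>k\<^sub>-\<^sub>1 + 1 + (k + 1) * lam\<close>.  The
  induction starts in dimension \<open>-1\<close>, where \<open>b = 0\<close> and the only cochain of weighted sum zero is zero.\<close>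

lemma norm_up_bound:
  assumes exp: "one_sided_local_spectral_expander X n m lam" "0 \<le> lam" and "-1 \<le> k" "k \<le> n - 1"
    and "(\<Sum>\<tau>\<in>faces X k. m \<tau> * \<phi> \<tau>) = 0"
  shows "inner (k + 1) (up k \<phi>) (up k \<phi>)
    \<le> (of_int k + 1 + (of_int k + 1) * (of_int k + 2) / 2 * lam) * inner k \<phi> \<phi>"
  using assms(3-)
proof (induction k arbitrary: \<phi> rule: int_ge_induct)
  case base
  have "faces X (- 1) = {{}}"
    using complex by (auto simp: faces_def finite_simplicial_complex_def)
  moreover from this have "m {} > 0" using m_pos[of "{}" "-1"] base by simp
  ultimately have "\<phi> {} = 0" using base by simp
  then have "up (- 1) \<phi> \<sigma> = 0" for \<sigma>
    unfolding up_def \<open>faces X (- 1) = {{}}\<close> by (intro sum.neutral) auto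
  then show ?case by (simp add: cochain_inner_def)
next
  case (step i)
  let ?b = "of_int i + 1 + (of_int i + 1) * (of_int i + 2) / 2 * lam"
  have i: "0 \<le> real_of_int i + 1" using step.hyps by linarith
  then have "0 \<le> (of_int i + 1) * (of_int i + 2) / 2 * lam"
    using exp(2) by (intro mult_nonneg_nonneg divide_nonneg_nonneg) auto
  then have "0 \<le> ?b" using i by linarith
  then have "inner i (down i \<phi>) (down i \<phi>) \<le> ?b * inner (i + 1) \<phi> \<phi>"
    using step by (intro norm_down_le_of_norm_up_le) auto
  then have "inner (i + 1 + 1) (up (i + 1) \<phi>) (up (i + 1) \<phi>)
      \<le> ?b * inner (i + 1) \<phi> \<phi> + (1 + (of_int (i + 1) + 1) * lam) * inner (i + 1) \<phi> \<phi>"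
    using norm_up_le_norm_down[OF exp, of "i + 1" \<phi>] step.hyps step.prems(1) by simp
  also have "\<dots> = (of_int (i + 1) + 1 + (of_int (i + 1) + 1) * (of_int (i + 1) + 2) / 2 * lam)
      * inner (i + 1) \<phi> \<phi>"
    by (simp add: field_simps)
  finally show ?case .
qed

end

section \<open>The norm of the upper walk\<close>

theorem theorem5p4:
  fixes X :: "'a set set" and n k :: int and m :: "'a set \<Rightarrow> real" and lam :: real
    and \<phi> :: "'a set \<Rightarrow> real"
  assumes "1 \<le> n"
    and "pure_complex X n"
    and "weight_function X n m"
    and "0 \<le> lam" and "lam \<le> 1"
    and "one_sided_local_spectral_expander X n m lam"
    and "0 \<le> k" and "k \<le> n - 1"
    and "\<phi> \<in> cochains0 X m k"
  shows "cochain_norm X m k (upper_walk X m k \<phi>)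
    \<le> ((of_int k + 1) / (of_int k + 2) + (of_int k + 1) / 2 * lam) * cochain_norm X m k \<phi>"
proof -
  interpret weighted_complex X n m
    using assms(2,3) by unfold_locales
  have k: "-1 \<le> k" "k \<le> n - 1" using assms(7,8) by auto
  \<comment> \<open>\<open>k + 2\<close> times the constant of the theorem, as \<open>upper_walk\<close> is \<open>down \<circ> up\<close> divided by \<open>k + 2\<close>\<close>
  define b where "b = of_int k + 1 + (of_int k + 1) * (of_int k + 2) / 2 * lam"
  have b: "0 \<le> b"
    unfolding b_def using assms(4,7) by (intro add_nonneg_nonneg mult_nonneg_nonneg) auto
  have up_bound: "inner (k + 1) (up k \<psi>) (up k \<psi>) \<le> b * inner k \<psi> \<psi>"
    if "(\<Sum>\<tau>\<in>faces X k. m \<tau> * \<psi> \<tau>) = 0" for \<psi>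
    unfolding b_def by (rule norm_up_bound[OF assms(6,4) k that])
  have \<phi>: "(\<Sum>\<tau>\<in>faces X k. m \<tau> * \<phi> \<tau>) = 0"
    using assms(9) by (simp add: cochains0_def)
  \<comment> \<open>the weighted sum of \<open>up k \<phi>\<close> vanishes, so the bound for \<open>down\<close> applies to it\<close>
  have "inner k (down k (up k \<phi>)) (down k (up k \<phi>)) \<le> b * inner (k + 1) (up k \<phi>) (up k \<phi>)"
    by (rule norm_down_le_of_norm_up_le[OF k b up_bound]) (simp_all add: total_up[OF k] \<phi>)
  also have "\<dots> \<le> b * (b * inner k \<phi> \<phi>)"
    by (rule mult_left_mono[OF up_bound[OF \<phi>] b])
  finally have bound: "inner k (down k (up k \<phi>)) (down k (up k \<phi>)) \<le> b\<^sup>2 * inner k \<phi> \<phi>"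
    by (simp add: power2_eq_square mult_ac)
  have "inner k (upper_walk X m k \<phi>) (upper_walk X m k \<phi>)
      = inner k (down k (up k \<phi>)) (down k (up k \<phi>)) / (of_int k + 2)\<^sup>2"
    unfolding cochain_inner_def sum_divide_distrib
    using assms(7,8) by (intro sum.cong refl) (simp add: upper_walk_eq_down_up power2_eq_square)
  also have "\<dots> \<le> b\<^sup>2 * inner k \<phi> \<phi> / (of_int k + 2)\<^sup>2"
    by (rule divide_right_mono[OF bound]) simp
  also have "\<dots> = (b / (of_int k + 2))\<^sup>2 * inner k \<phi> \<phi>"
    by (simp add: power_divide)
  finally have "cochain_norm X m k (upper_walk X m k \<phi>)
      \<le> sqrt ((b / (of_int k + 2))\<^sup>2 * inner k \<phi> \<phi>)"
    unfolding cochain_norm_def by (rule real_sqrt_le_mono)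
  also have "\<dots> = b / (of_int k + 2) * cochain_norm X m k \<phi>"
    using b assms(7) by (simp add: real_sqrt_mult cochain_norm_def)
  also have "b / (of_int k + 2) = (of_int k + 1) / (of_int k + 2) + (of_int k + 1) / 2 * lam"
  proof -
    have "b = (of_int k + 1) + (of_int k + 1) / 2 * lam * (of_int k + 2)"
      by (simp add: b_def)
    moreover have "real_of_int k + 2 \<noteq> 0" using assms(7) by linarith
    moreover have "(a + c * y) / y = a / y + c" if "y \<noteq> 0" for a c y :: real
      using that by (simp add: add_divide_distrib)
    ultimately show ?thesis by (simp only:)
  qed
  finally show ?thesis .
qed

end
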